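(* Let $S$ be a semiregular ring satisfying the Schröder-Bernstein (SB) property. Then both $\bar S=S/\mathrm{J}(S)$ and $S$ satisfy the perspective-Schröder-Bernstein (PSB) property.
   Context: Rings are associative with unity; $\mathrm{J}(S)$ is the Jacobson radical. A ring $S$ is semiregular if $S/\mathrm{J}(S)$ is von Neumann regular and idempotents lift modulo $\mathrm{J}(S)$. Write $A\subseteq^{\oplus}M$ if $A$ is a direct summand of $M$. Two direct summands $A,B$ of a module $M$ are perspective, written $A\sim_p B$, if there is a submodule $C$ with $M=A\oplus C=B\oplus C$. $M$ has the SB-property if any two direct summands $A,B$ of $M$ such that $A$ is isomorphic to a direct summand of $B$ and $B$ is isomorphic to a direct summand of $A$ satisfy $A\cong B$. $M$ has the PSB-property if for any direct summands $A,B$ of $M$: whenever $A\sim_p B'$ for some $B'\subseteq^{\oplus}B$ and $B\sim_p A'$ for some $A'\subseteq^{\oplus}A$ (perspectivity taken in $M$), then $A\sim_p B$. A ring $R$ has the SB-property (respectively PSB-property) if the right module $R_R$ does. *)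

theory Defs
  imports "HOL-Algebra.Module" "HOL-Algebra.QuotRing"
begin

text \<open>
  The library locale \<open>module\<close> requires a commutative ring of scalars, so right modules over an
  arbitrary unital ring are introduced here.  They reuse the library record \<^type>\<open>module\<close>, whose
  scalar is written on the left: \<open>a \<odot> x\<close> stands for the right action \<open>x \<cdot> a\<close>, which is why the
  associativity law below reverses the order of the scalars.  The fields \<open>mult\<close> and \<open>one\<close> inherited
  by that record play no role.  The library locale \<open>submodule\<close> mentions only the additive
  structure and closure under \<open>\<odot>\<close>, and applies to right modules unchanged.
\<close>

locale right_module = R?: ring R + M?: abelian_group M
  for R :: "('a, 'r) ring_scheme" (structure) and M :: "('a, 'b, 'm) module_scheme" (structure) +
  assumes smult_closed:
      "\<lbrakk>a \<in> carrier R; x \<in> carrier M\<rbrakk> \<Longrightarrow> a \<odot>\<^bsub>M\<^esub> x \<in> carrier M"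
    and smult_l_distr:
      "\<lbrakk>a \<in> carrier R; b \<in> carrier R; x \<in> carrier M\<rbrakk>
        \<Longrightarrow> (a \<oplus>\<^bsub>R\<^esub> b) \<odot>\<^bsub>M\<^esub> x = a \<odot>\<^bsub>M\<^esub> x \<oplus>\<^bsub>M\<^esub> b \<odot>\<^bsub>M\<^esub> x"
    and smult_r_distr:
      "\<lbrakk>a \<in> carrier R; x \<in> carrier M; y \<in> carrier M\<rbrakk>
        \<Longrightarrow> a \<odot>\<^bsub>M\<^esub> (x \<oplus>\<^bsub>M\<^esub> y) = a \<odot>\<^bsub>M\<^esub> x \<oplus>\<^bsub>M\<^esub> a \<odot>\<^bsub>M\<^esub> y"
    and smult_assoc_right:
      "\<lbrakk>a \<in> carrier R; b \<in> carrier R; x \<in> carrier M\<rbrakk>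
        \<Longrightarrow> (a \<otimes>\<^bsub>R\<^esub> b) \<odot>\<^bsub>M\<^esub> x = b \<odot>\<^bsub>M\<^esub> (a \<odot>\<^bsub>M\<^esub> x)"
    and smult_one:
      "x \<in> carrier M \<Longrightarrow> \<one>\<^bsub>R\<^esub> \<odot>\<^bsub>M\<^esub> x = x"

definition right_regular_module :: "('a, 'r) ring_scheme \<Rightarrow> ('a, 'a) module" where
  "right_regular_module R =
     \<lparr>carrier = carrier R, mult = mult R, one = one R, zero = zero R, add = add R,
      smult = (\<lambda>a x. x \<otimes>\<^bsub>R\<^esub> a)\<rparr>"

lemma right_module_right_regular_module:
  assumes "ring R"
  shows "right_module R (right_regular_module R)"
proof -
  interpret ring R by fact
  have "abelian_group (right_regular_module R)"
    by (rule abelian_groupI)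
      (auto simp: right_regular_module_def a_ac intro: add.l_inv_ex)
  then show ?thesis
    unfolding right_module_def right_module_axioms_def
    by (simp add: right_regular_module_def ring_axioms l_distr r_distr m_assoc)
qed

definition internal_direct_sum ::
    "('a, 'r) ring_scheme \<Rightarrow> ('a, 'b, 'm) module_scheme \<Rightarrow> 'b set \<Rightarrow> 'b set \<Rightarrow> bool" where
  "internal_direct_sum R M A C \<longleftrightarrow>
     submodule A R M \<and> submodule C R M \<and> A <+>\<^bsub>M\<^esub> C = carrier M \<and> A \<inter> C = {\<zero>\<^bsub>M\<^esub>}"

definition direct_summand ::
    "('a, 'r) ring_scheme \<Rightarrow> ('a, 'b, 'm) module_scheme \<Rightarrow> 'b set \<Rightarrow> bool" where
  "direct_summand R M A \<longleftrightarrow> (\<exists>C. internal_direct_sum R M A C)"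

definition module_isos ::
    "('a, 'r) ring_scheme \<Rightarrow> ('a, 'b, 'm) module_scheme \<Rightarrow> ('a, 'c, 'n) module_scheme
      \<Rightarrow> ('b \<Rightarrow> 'c) set" where
  "module_isos R M N =
     {f \<in> iso (add_monoid M) (add_monoid N).
        \<forall>a\<in>carrier R. \<forall>x\<in>carrier M. f (a \<odot>\<^bsub>M\<^esub> x) = a \<odot>\<^bsub>N\<^esub> f x}"

definition isomorphic_submodules ::
    "('a, 'r) ring_scheme \<Rightarrow> ('a, 'b, 'm) module_scheme \<Rightarrow> 'b set \<Rightarrow> 'b set \<Rightarrow> bool" where
  "isomorphic_submodules R M A B \<longleftrightarrow>
     module_isos R (M\<lparr>carrier := A\<rparr>) (M\<lparr>carrier := B\<rparr>) \<noteq> {}"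

definition perspective ::
    "('a, 'r) ring_scheme \<Rightarrow> ('a, 'b, 'm) module_scheme \<Rightarrow> 'b set \<Rightarrow> 'b set \<Rightarrow> bool" where
  "perspective R M A B \<longleftrightarrow>
     (\<exists>C. internal_direct_sum R M A C \<and> internal_direct_sum R M B C)"

definition SB_module :: "('a, 'r) ring_scheme \<Rightarrow> ('a, 'b, 'm) module_scheme \<Rightarrow> bool" where
  "SB_module R M \<longleftrightarrow>
     (\<forall>A B. direct_summand R M A \<longrightarrow> direct_summand R M B \<longrightarrow>
        (\<exists>B'. direct_summand R (M\<lparr>carrier := B\<rparr>) B' \<and> isomorphic_submodules R M A B') \<longrightarrow>
        (\<exists>A'. direct_summand R (M\<lparr>carrier := A\<rparr>) A' \<and> isomorphic_submodules R M B A') \<longrightarrow>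
        isomorphic_submodules R M A B)"

definition PSB_module :: "('a, 'r) ring_scheme \<Rightarrow> ('a, 'b, 'm) module_scheme \<Rightarrow> bool" where
  "PSB_module R M \<longleftrightarrow>
     (\<forall>A B. direct_summand R M A \<longrightarrow> direct_summand R M B \<longrightarrow>
        (\<exists>B'. direct_summand R (M\<lparr>carrier := B\<rparr>) B' \<and> perspective R M A B') \<longrightarrow>
        (\<exists>A'. direct_summand R (M\<lparr>carrier := A\<rparr>) A' \<and> perspective R M B A') \<longrightarrow>
        perspective R M A B)"

definition SB_ring :: "('a, 'r) ring_scheme \<Rightarrow> bool" where
  "SB_ring R \<longleftrightarrow> SB_module R (right_regular_module R)"

definition PSB_ring :: "('a, 'r) ring_scheme \<Rightarrow> bool" where
  "PSB_ring R \<longleftrightarrow> PSB_module R (right_regular_module R)"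

definition right_ideal :: "'a set \<Rightarrow> ('a, 'r) ring_scheme \<Rightarrow> bool" where
  "right_ideal I R \<longleftrightarrow> submodule I R (right_regular_module R)"

definition maximal_right_ideal :: "'a set \<Rightarrow> ('a, 'r) ring_scheme \<Rightarrow> bool" where
  "maximal_right_ideal I R \<longleftrightarrow>
     right_ideal I R \<and> I \<noteq> carrier R \<and>
     (\<forall>K. right_ideal K R \<longrightarrow> I \<subseteq> K \<longrightarrow> K = I \<or> K = carrier R)"

text \<open>
  Intersecting with the carrier gives the radical of the zero ring, which has no maximal right
  ideals, its intended value.
\<close>

definition jacobson_radical :: "('a, 'r) ring_scheme \<Rightarrow> 'a set" where
  "jacobson_radical R = carrier R \<inter> \<Inter>{I. maximal_right_ideal I R}"

definition von_neumann_regular :: "('a, 'r) ring_scheme \<Rightarrow> bool" where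
  "von_neumann_regular R \<longleftrightarrow>
     (\<forall>a\<in>carrier R. \<exists>x\<in>carrier R. a \<otimes>\<^bsub>R\<^esub> x \<otimes>\<^bsub>R\<^esub> a = a)"

definition idempotents_lift_modulo :: "('a, 'r) ring_scheme \<Rightarrow> 'a set \<Rightarrow> bool" where
  "idempotents_lift_modulo R I \<longleftrightarrow>
     (\<forall>u\<in>carrier (R Quot I). u \<otimes>\<^bsub>R Quot I\<^esub> u = u \<longrightarrow>
        (\<exists>e\<in>carrier R. e \<otimes>\<^bsub>R\<^esub> e = e \<and> I +>\<^bsub>R\<^esub> e = u))"

definition semiregular :: "('a, 'r) ring_scheme \<Rightarrow> bool" where
  "semiregular R \<longleftrightarrow>
     von_neumann_regular (R Quot jacobson_radical R) \<and>
     idempotents_lift_modulo R (jacobson_radical R)"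

end

theory Submission
  imports Defs
begin

text \<open>
  Direct summands of \<open>R\<^sub>R\<close> are the right ideals \<open>eR\<close> with \<open>e\<close> idempotent, so isomorphism and
  perspectivity of summands become equations between idempotents.

  Over a regular ring, write \<open>eR = D \<oplus> K'\<close> and \<open>fR = D \<oplus> K\<close> with \<open>D = eR \<inter> fR\<close>.  If \<open>eR\<close> is
  perspective to a summand of \<open>fR\<close>, composing the perspectivity map with the projection of \<open>fR\<close>
  onto \<open>K\<close> embeds \<open>K'\<close> into \<open>K\<close>, because that map fixes the points it leaves in \<open>eR\<close>.  By
  symmetry and SB, \<open>K\<close> and \<open>K'\<close> are isomorphic, and the graph of an isomorphism together with a
  complement of \<open>eR + fR\<close> is a common complement of \<open>eR\<close> and \<open>fR\<close>.

  For a semiregular ring \<open>S\<close>, SB passes to the regular ring \<open>S/J\<close>, since idempotents and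
  embeddings of the corresponding summands lift.  Perspectivity lifts back from \<open>S/J\<close> to \<open>S\<close>,
  since elements congruent to \<open>1\<close> modulo \<open>J\<close> are right invertible.
\<close>

section \<open>Idempotents\<close>

definition is_idempotent :: "('a, 'r) ring_scheme \<Rightarrow> 'a \<Rightarrow> bool" where
  "is_idempotent R e \<longleftrightarrow> e \<in> carrier R \<and> e \<otimes>\<^bsub>R\<^esub> e = e"

definition iso_idem :: "('a, 'r) ring_scheme \<Rightarrow> 'a \<Rightarrow> 'a \<Rightarrow> bool" where
  "iso_idem R e f \<longleftrightarrow>
     (\<exists>a\<in>carrier R. \<exists>b\<in>carrier R. a \<otimes>\<^bsub>R\<^esub> b = f \<and> b \<otimes>\<^bsub>R\<^esub> a = e)"

text \<open>\<open>eR\<close> is isomorphic to a direct summand of \<open>fR\<close>.\<close>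

definition emb_idem :: "('a, 'r) ring_scheme \<Rightarrow> 'a \<Rightarrow> 'a \<Rightarrow> bool" where
  "emb_idem R e f \<longleftrightarrow>
     (\<exists>a\<in>carrier R. \<exists>b\<in>carrier R. b \<otimes>\<^bsub>R\<^esub> f \<otimes>\<^bsub>R\<^esub> a = e)"

text \<open>
  \<open>p\<close> is a projection onto \<open>eR\<close> that maps \<open>fR\<close> bijectively onto \<open>eR\<close>, with inverse given by \<open>s\<close>;
  its kernel is the common complement.
\<close>

definition persp_idem :: "('a, 'r) ring_scheme \<Rightarrow> 'a \<Rightarrow> 'a \<Rightarrow> bool" where
  "persp_idem R e f \<longleftrightarrow>
     (\<exists>p\<in>carrier R. \<exists>s\<in>carrier R. e \<otimes>\<^bsub>R\<^esub> p = p \<and> p \<otimes>\<^bsub>R\<^esub> e = e \<and>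
        f \<otimes>\<^bsub>R\<^esub> s = s \<and> p \<otimes>\<^bsub>R\<^esub> s = e \<and> s \<otimes>\<^bsub>R\<^esub> p \<otimes>\<^bsub>R\<^esub> f = f)"

definition SB_idem :: "('a, 'r) ring_scheme \<Rightarrow> bool" where
  "SB_idem R \<longleftrightarrow>
     (\<forall>e f. is_idempotent R e \<longrightarrow> is_idempotent R f \<longrightarrow> emb_idem R e f \<longrightarrow> emb_idem R f e \<longrightarrow>
        iso_idem R e f)"

text \<open>\<open>f \<otimes> f' = f'\<close> expresses that f'R is contained in fR. As f'R is a
  summand of R, it is then a summand of fR too.\<close>

definition PSB_idem :: "('a, 'r) ring_scheme \<Rightarrow> bool" where
  "PSB_idem R \<longleftrightarrow>
     (\<forall>e f e' f'. is_idempotent R e \<longrightarrow> is_idempotent R f \<longrightarrow> is_idempotent R e' \<longrightarrow> is_idempotent R f' \<longrightarrow>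
        f \<otimes>\<^bsub>R\<^esub> f' = f' \<longrightarrow> persp_idem R e f' \<longrightarrow>
        e \<otimes>\<^bsub>R\<^esub> e' = e' \<longrightarrow> persp_idem R f e' \<longrightarrow> persp_idem R e f)"

context ring
begin

text \<open>Rewrites with a known product inside right-nested terms, where that product is not
  itself a subterm.\<close>

lemma mult_eq_assoc:
  "\<lbrakk>a \<otimes> b = c; a \<in> carrier R; b \<in> carrier R; x \<in> carrier R\<rbrakk> \<Longrightarrow> a \<otimes> (b \<otimes> x) = c \<otimes> x"
  by (simp flip: m_assoc)

lemma minus_eq_zeroD:
  assumes "a \<ominus> b = \<zero>" "a \<in> carrier R" "b \<in> carrier R"
  shows "a = b"
  using assms by (simp add: minus_eq) (metis minus_equality minus_minus a_inv_closed)

text \<open>Both \<open>f \<otimes> a\<close> and \<open>a \<otimes> e\<close> equal aba, and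
  symmetrically for \<open>b\<close>. Hence replacing \<open>a\<close> by
  \<open>a \<otimes> e\<close> and \<open>b\<close> by \<open>b \<otimes> f\<close> moves the
  witnesses into the corners and keeps both products.\<close>

lemma iso_idemE:
  assumes "iso_idem R e f" and "is_idempotent R e" and "is_idempotent R f"
  obtains a b where "a \<in> carrier R" "b \<in> carrier R" "a \<otimes> b = f" "b \<otimes> a = e"
    "f \<otimes> a = a" "a \<otimes> e = a" "e \<otimes> b = b" "b \<otimes> f = b"
proof -
  obtain a b where [simp]: "a \<in> carrier R" "b \<in> carrier R" and ab: "a \<otimes> b = f" "b \<otimes> a = e"
    using assms(1) unfolding iso_idem_def by blast
  have [simp]: "e \<in> carrier R" "f \<in> carrier R" and ee: "e \<otimes> e = e" and ff: "f \<otimes> f = f"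
    using assms by (auto simp: is_idempotent_def)
  have fa: "f \<otimes> a = a \<otimes> e" and eb: "e \<otimes> b = b \<otimes> f"
    by (simp_all add: m_assoc flip: ab)
  have fae: "f \<otimes> (a \<otimes> e) = a \<otimes> e"
    by (simp add: mult_eq_assoc[OF ff] flip: fa)
  have ebf: "e \<otimes> (b \<otimes> f) = b \<otimes> f"
    by (simp add: mult_eq_assoc[OF ee] flip: eb)
  show ?thesis
  proof (rule that[of "a \<otimes> e" "b \<otimes> f"])
    show "a \<otimes> e \<otimes> (b \<otimes> f) = f"
      by (simp add: m_assoc ebf) (simp add: ab(1) ff flip: m_assoc)
    show "b \<otimes> f \<otimes> (a \<otimes> e) = e"
      by (simp add: m_assoc fae) (simp add: ab(2) ee flip: m_assoc)
  qed (simp_all add: m_assoc ee ff fae ebf)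
qed

section \<open>Regular rings\<close>

text \<open>
  Here \<open>dR = eR \<inter> fR\<close> and \<open>fR = dR \<oplus> kR\<close>, while \<open>\<pi>\<close> kills \<open>eR\<close> and is the identity on \<open>kR\<close>.
\<close>

lemma regular_meet_complement:
  assumes "von_neumann_regular R" and "is_idempotent R e" and "is_idempotent R f"
  obtains d k \<pi> where "d \<in> carrier R" "k \<in> carrier R" "\<pi> \<in> carrier R"
    "d \<oplus> k = f" "e \<otimes> d = d" "f \<otimes> d = d" "d \<otimes> d = d" "d \<otimes> f = d"
    "d \<otimes> k = \<zero>" "k \<otimes> d = \<zero>" "f \<otimes> k = k" "k \<otimes> f = k" "k \<otimes> k = k"
    "\<pi> \<otimes> e = \<zero>" "\<pi> \<otimes> f = k"
proof -
  have [simp]: "e \<in> carrier R" "e \<otimes> e = e" "f \<in> carrier R" "f \<otimes> f = f"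
    using assms by (auto simp: is_idempotent_def)
  \<comment> \<open>Left multiplication by \<open>w\<close> has kernel eR, so a quasi-inverse of
    \<open>w \<otimes> f\<close> splits off the part of fR that lies in eR.\<close>
  define w where "w = \<one> \<ominus> e"
  have [simp]: "w \<in> carrier R" by (simp add: w_def)
  have we: "w \<otimes> e = \<zero>" and ew: "e \<otimes> w = \<zero>" and ww: "w \<otimes> w = w"
    by (simp_all add: w_def ring_simprules)
  obtain y where y [simp]: "y \<in> carrier R" and wfy: "w \<otimes> f \<otimes> y \<otimes> (w \<otimes> f) = w \<otimes> f"
    using assms(1) unfolding von_neumann_regular_def by (meson \<open>w \<in> _\<close> \<open>f \<in> _\<close> m_closed)
  define \<pi> where "\<pi> = f \<otimes> y \<otimes> w"
  define k where "k = \<pi> \<otimes> f"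
  define d where "d = f \<ominus> k"
  have C [simp]: "\<pi> \<in> carrier R" "k \<in> carrier R" "d \<in> carrier R"
    by (simp_all add: \<pi>_def k_def d_def)
  \<comment> \<open>\<open>w\<close> does not distinguish \<open>k\<close> from \<open>f\<close>, so
    it kills their difference \<open>d\<close>; this puts \<open>d\<close> in eR.\<close>
  have wk: "w \<otimes> k = w \<otimes> f" using wfy by (simp add: k_def \<pi>_def m_assoc)
  have fk: "f \<otimes> k = k" by (simp add: k_def \<pi>_def mult_eq_assoc[of f f f] m_assoc)
  have kf: "k \<otimes> f = k" by (simp add: k_def m_assoc)
  have "k \<otimes> k = \<pi> \<otimes> k" by (simp add: k_def m_assoc mult_eq_assoc[OF fk[unfolded k_def]] fk[unfolded k_def])
  also have "\<dots> = f \<otimes> y \<otimes> (w \<otimes> k)" by (simp add: \<pi>_def m_assoc)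
  also have "\<dots> = k" unfolding wk by (simp add: k_def \<pi>_def m_assoc)
  finally have kk: "k \<otimes> k = k" .
  have wd: "w \<otimes> d = \<zero>" using wk by (simp add: d_def ring_simprules)
  have "d = (w \<oplus> e) \<otimes> d" by (simp add: w_def ring_simprules)
  then have ed: "e \<otimes> d = d" using wd by (simp add: l_distr)
  show ?thesis
  proof (rule that[of d k \<pi>])
    show "d \<oplus> k = f" by (simp add: d_def ring_simprules)
    show "e \<otimes> d = d" by (fact ed)
    show "\<pi> \<otimes> e = \<zero>" by (simp add: \<pi>_def m_assoc we)
    show "\<pi> \<otimes> f = k" by (simp add: k_def)
  qed (use fk kf kk in \<open>simp_all add: d_def ring_simprules\<close>)
qed

text \<open>Following \<open>s\<close> by \<open>k\<close> maps k'R to kR. This is injective: if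
  \<open>k\<close> kills sz, then sz lies in dR, hence in eR, where \<open>p\<close> is the
  identity; so sz = psz = z lies in both dR and k'R and vanishes. Regularity turns injectivity into
  a left inverse.\<close>

lemma emb_idem_complement:
  assumes reg: "von_neumann_regular R"
    and C [simp]: "e \<in> carrier R" "f \<in> carrier R" "f' \<in> carrier R" "d \<in> carrier R" "k \<in> carrier R"
      "d' \<in> carrier R" "k' \<in> carrier R" "\<pi>' \<in> carrier R"
    and f': "f \<otimes> f' = f'" and persp: "persp_idem R e f'"
    and dk: "d \<oplus> k = f" and ed: "e \<otimes> d = d" and fd: "f \<otimes> d = d"
    and k': "e \<otimes> k' = k'" "k' \<otimes> k' = k'" and \<pi>': "\<pi>' \<otimes> f = \<zero>" "\<pi>' \<otimes> e = k'"
  shows "emb_idem R k' k"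
proof -
  obtain p s where [simp]: "p \<in> carrier R" "s \<in> carrier R" and pe: "p \<otimes> e = e"
    and fs': "f' \<otimes> s = s" and ps: "p \<otimes> s = e"
    using persp unfolding persp_idem_def by blast
  have fs: "f \<otimes> s = s" using f' fs' by (metis C m_assoc \<open>s \<in> _\<close>)
  define t where "t = k \<otimes> s \<otimes> k'"
  have [simp]: "t \<in> carrier R" by (simp add: t_def)
  obtain y where y [simp]: "y \<in> carrier R" and tyt: "t \<otimes> y \<otimes> t = t"
    using reg unfolding von_neumann_regular_def by (meson \<open>t \<in> _\<close>)
  \<comment> \<open>\<open>z\<close> measures how far \<open>k' \<otimes> y\<close> is from
    inverting \<open>t\<close> on the left. It is killed by \<open>t\<close>, so injectivity will
    force it to be zero.\<close>
  define z where "z = k' \<ominus> k' \<otimes> y \<otimes> t"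
  have z [simp]: "z \<in> carrier R" by (simp add: z_def)
  have k'z: "k' \<otimes> z = z"
    by (simp add: z_def minus_eq r_distr r_minus m_assoc k' mult_eq_assoc[OF k'(2)])
  have ez: "e \<otimes> z = z" by (metis k'z k'(1) m_assoc C(1,7) z)
  have tk': "t \<otimes> k' = t" by (simp add: t_def m_assoc k')
  have "t \<otimes> z = t \<otimes> k' \<ominus> t \<otimes> k' \<otimes> y \<otimes> t"
    by (simp add: z_def minus_eq r_distr r_minus m_assoc)
  also have "\<dots> = \<zero>" by (simp add: tk' tyt minus_eq r_neg)
  finally have "t \<otimes> z = \<zero>" .
  then have ksz: "k \<otimes> (s \<otimes> z) = \<zero>" by (simp add: t_def m_assoc k'z)
  have "s \<otimes> z = (d \<oplus> k) \<otimes> (s \<otimes> z)" by (simp add: dk mult_eq_assoc[OF fs])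
  then have dsz: "s \<otimes> z = d \<otimes> (s \<otimes> z)" by (simp add: l_distr ksz)
  then have esz: "e \<otimes> (s \<otimes> z) = s \<otimes> z" by (metis ed m_assoc C(1,4) z m_closed \<open>s \<in> _\<close>)
  have "s \<otimes> z = p \<otimes> (s \<otimes> z)" by (metis esz pe m_assoc C(1) z m_closed \<open>s \<in> _\<close> \<open>p \<in> _\<close>)
  also have "\<dots> = z" by (simp add: mult_eq_assoc[OF ps] ez)
  finally have dz: "d \<otimes> z = z" using dsz by simp
  \<comment> \<open>Since \<open>d\<close> lies in eR, \<open>\<pi>'\<close> acts on it as
    \<open>k'\<close> does; since \<open>d\<close> lies in fR, \<open>\<pi>'\<close> kills
    it.\<close>
  have "k' \<otimes> d = \<pi>' \<otimes> (e \<otimes> d)" by (simp add: \<pi>'(2) flip: m_assoc)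
  also have "\<dots> = \<pi>' \<otimes> (f \<otimes> d)" by (simp add: ed fd)
  also have "\<dots> = \<zero>" by (simp add: mult_eq_assoc[OF \<pi>'(1)])
  finally have "k' \<otimes> (d \<otimes> z) = \<zero>" by (simp add: mult_eq_assoc)
  then have "z = \<zero>" by (simp add: dz k'z)
  then have "k' = k' \<otimes> y \<otimes> t" by (simp add: z_def minus_eq_zeroD)
  then have "k' \<otimes> y \<otimes> k \<otimes> (s \<otimes> k') = k'" by (simp add: t_def m_assoc)
  then show ?thesis unfolding emb_idem_def by (metis C(7) y m_closed \<open>s \<in> _\<close>)
qed

lemma PSB_idem_if_regular:
  assumes reg: "von_neumann_regular R" and SB: "SB_idem R"
  shows "PSB_idem R"
  unfolding PSB_idem_def
proof (intro allI impI)
  fix e f e' f'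
  assume e: "is_idempotent R e" and f: "is_idempotent R f"
    and e'f': "is_idempotent R e'" "is_idempotent R f'"
    and f'p: "f \<otimes> f' = f'" "persp_idem R e f'" and e'p: "e \<otimes> e' = e'" "persp_idem R f e'"
  have [simp]: "e \<in> carrier R" "f \<in> carrier R" "e' \<in> carrier R" "f' \<in> carrier R"
    using e f e'f' by (auto simp: is_idempotent_def)
  obtain d k \<pi> where C [simp]: "d \<in> carrier R" "k \<in> carrier R" "\<pi> \<in> carrier R"
    and d: "d \<oplus> k = f" "e \<otimes> d = d" "f \<otimes> d = d" "d \<otimes> d = d" "d \<otimes> f = d"
    and k: "d \<otimes> k = \<zero>" "k \<otimes> d = \<zero>" "f \<otimes> k = k" "k \<otimes> f = k" "k \<otimes> k = k"
    and \<pi>: "\<pi> \<otimes> e = \<zero>" "\<pi> \<otimes> f = k"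
    using regular_meet_complement[OF reg e f] .
  obtain d' k' \<pi>' where C' [simp]: "d' \<in> carrier R" "k' \<in> carrier R" "\<pi>' \<in> carrier R"
    and d': "d' \<oplus> k' = e" "f \<otimes> d' = d'" "e \<otimes> d' = d'" "d' \<otimes> d' = d'" "d' \<otimes> e = d'"
    and k': "d' \<otimes> k' = \<zero>" "k' \<otimes> d' = \<zero>" "e \<otimes> k' = k'" "k' \<otimes> e = k'" "k' \<otimes> k' = k'"
    and \<pi>': "\<pi>' \<otimes> f = \<zero>" "\<pi>' \<otimes> e = k'"
    using regular_meet_complement[OF reg f e] .
  have "emb_idem R k' k"
    by (rule emb_idem_complement[OF reg, of e f f' d k d' k' \<pi>']) (simp_all add: f'p d k' \<pi>')
  moreover have "emb_idem R k k'"
    by (rule emb_idem_complement[OF reg, of f e e' d' k' d k \<pi>]) (simp_all add: e'p d' k \<pi>)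
  ultimately have "iso_idem R k k'"
    using SB k(5) k'(5) unfolding SB_idem_def is_idempotent_def by simp
  then obtain a b where [simp]: "a \<in> carrier R" "b \<in> carrier R"
    and ab: "a \<otimes> b = k'" "b \<otimes> a = k"
    and k'a: "k' \<otimes> a = a" and ak: "a \<otimes> k = a" and kb: "k \<otimes> b = b" and bk': "b \<otimes> k' = b"
    using k(5) k'(5) by (elim iso_idemE) (auto simp: is_idempotent_def)
  have \<pi>d: "\<pi> \<otimes> d = \<zero>" using \<pi>(1) d(2) by (metis C \<open>e \<in> _\<close> m_assoc l_null)
  have kd': "k \<otimes> d' = \<zero>"
    using \<pi> d'(2,3) by (metis C C' \<open>e \<in> _\<close> \<open>f \<in> _\<close> m_assoc l_null)
  have k'd: "k' \<otimes> d = \<zero>"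
    using \<pi>' d(2,3) by (metis C C' \<open>e \<in> _\<close> \<open>f \<in> _\<close> m_assoc l_null)
  have \<pi>k: "\<pi> \<otimes> k = k" using \<pi>(2) k(3,5) by (metis C \<open>f \<in> _\<close> m_assoc)
  have ea: "e \<otimes> a = a" using k'a k'(3) by (metis C' \<open>e \<in> _\<close> \<open>a \<in> _\<close> m_assoc)
  have fb: "f \<otimes> b = b" using kb k(3) by (metis C \<open>f \<in> _\<close> \<open>b \<in> _\<close> m_assoc)
  have ee: "e \<otimes> e = e" using e by (simp add: is_idempotent_def)
  \<comment> \<open>\<open>d\<close> and \<open>d'\<close> project onto the same intersection of eR
    and fR, along possibly different kernels, so each is the identity on the range of the
    other.\<close>
  have d'd: "d' \<otimes> d = d"
  proof -
    have "d = (d' \<oplus> k') \<otimes> d" by (simp add: d d'(1))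
    then show ?thesis by (simp add: l_distr k'd)
  qed
  have dd': "d \<otimes> d' = d'"
  proof -
    have "d' = (d \<oplus> k) \<otimes> d'" by (simp add: d d')
    then show ?thesis by (simp add: l_distr kd')
  qed
  \<comment> \<open>The kernel of \<open>p\<close> contains the graph \<open>{x - a x | x \<in> kR}\<close>.\<close>
  define p where "p = e \<otimes> (\<one> \<ominus> \<pi>) \<oplus> a \<otimes> \<pi>"
  \<comment> \<open>On eR this is the identity on d'R and \<open>b\<close> on k'R. It inverts
    \<open>p\<close> on fR, which is the identity on dR and \<open>a\<close> on kR.\<close>
  define s where "s = d' \<oplus> b"
  have [simp]: "p \<in> carrier R" "s \<in> carrier R" by (simp_all add: p_def s_def)
  have ep: "e \<otimes> p = p"
    by (simp add: p_def r_distr mult_eq_assoc[OF ee] mult_eq_assoc[OF ea])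
  have pe: "p \<otimes> e = e"
    by (simp add: p_def l_distr r_distr m_assoc \<pi> minus_eq l_minus ee)
  have fs: "f \<otimes> s = s"
    by (simp add: s_def r_distr d' fb)
  have pd: "p \<otimes> d = d" using pe d(2) by (metis C \<open>e \<in> _\<close> \<open>p \<in> _\<close> m_assoc)
  have pk: "p \<otimes> k = a"
    by (simp add: p_def l_distr m_assoc minus_eq l_minus \<pi>k ak r_neg)
  have pf: "p \<otimes> f = d \<oplus> a"
    by (simp add: d(1)[symmetric] r_distr pd pk)
  have dz: "d \<otimes> b = \<zero>" using kb k(1) by (metis C \<open>b \<in> _\<close> m_assoc l_null)
  have az: "a \<otimes> d' = \<zero>" using ak kd' by (metis C C' \<open>a \<in> _\<close> m_assoc r_null)
  have "p \<otimes> s = (p \<otimes> f) \<otimes> s" by (simp add: m_assoc fs)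
  also have "\<dots> = d' \<oplus> k'"
    by (simp add: pf s_def l_distr r_distr dd' dz az ab)
  finally have ps: "p \<otimes> s = e" by (simp add: d')
  have d'a: "d' \<otimes> a = \<zero>" using k'a k'(1) by (metis C' \<open>a \<in> _\<close> m_assoc l_null)
  have bd: "b \<otimes> d = \<zero>" using bk' k'd by (metis C C' \<open>b \<in> _\<close> m_assoc r_null)
  have "s \<otimes> p \<otimes> f = s \<otimes> (d \<oplus> a)" by (simp add: m_assoc pf)
  also have "\<dots> = d \<oplus> k"
    by (simp add: s_def l_distr r_distr d'd d'a bd ab)
  finally have spf: "s \<otimes> p \<otimes> f = f" by (simp add: d)
  show "persp_idem R e f"
    unfolding persp_idem_def using ep pe fs ps spf \<open>p \<in> _\<close> \<open>s \<in> _\<close> by blast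
qed

end

section \<open>Lifting along a ring homomorphism\<close>

text \<open>These are the properties of the map from S to S/J on which the transfer rests.
  \<open>unit_lift\<close> says that the kernel lies in the radical; it asks for right inverses
  because an intersection of maximal right ideals yields these directly.\<close>

locale lifting_hom = ring_hom_ring R Q h for R (structure) and Q (structure) and h +
  assumes surj: "h ` carrier R = carrier Q"
    and unit_lift: "\<lbrakk>x \<in> carrier R; h x = \<one>\<^bsub>Q\<^esub>\<rbrakk> \<Longrightarrow> \<exists>u\<in>carrier R. x \<otimes>\<^bsub>R\<^esub> u = \<one>\<^bsub>R\<^esub>"
    and idempotent_lift: "is_idempotent Q u \<Longrightarrow> \<exists>e. is_idempotent R e \<and> h e = u"
begin

lemma surjE:
  assumes "y \<in> carrier Q"
  obtains x where "x \<in> carrier R" "h x = y"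
  using assms surj by (metis imageE)

lemma hom_idempotent: "is_idempotent R e \<Longrightarrow> is_idempotent Q (h e)"
  by (auto simp: is_idempotent_def simp flip: hom_mult)

text \<open>Adding \<open>\<one> \<ominus> e\<close> to \<open>x\<close> gives an element over the
  identity of \<open>Q\<close>, which has a right inverse; multiplying on the left by
  \<open>e\<close> recovers \<open>x\<close>.\<close>

lemma corner_right_inverse:
  assumes e: "is_idempotent R e" and x: "x \<in> carrier R" "e \<otimes> x = x" "x \<otimes> e = x" and hx: "h x = h e"
  obtains u where "u \<in> carrier R" "x \<otimes> u = e" "h u = \<one>\<^bsub>Q\<^esub>"
proof -
  have [simp]: "e \<in> carrier R" and ee: "e \<otimes> e = e" using e by (auto simp: is_idempotent_def)
  define z where "z = \<one> \<ominus> e \<oplus> x"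
  have [simp]: "z \<in> carrier R" using x by (simp add: z_def)
  have hz: "h z = \<one>\<^bsub>Q\<^esub>" using x hx by (simp add: z_def R.minus_eq S.r_neg S.l_neg S.a_assoc)
  obtain u where [simp]: "u \<in> carrier R" and zu: "z \<otimes> u = \<one>"
    using unit_lift[OF _ hz] \<open>z \<in> _\<close> by blast
  have "e \<otimes> z = x" using x by (simp add: z_def R.r_distr R.minus_eq R.r_minus ee R.r_neg)
  then have "x \<otimes> u = e" using zu by (metis R.m_assoc R.r_one \<open>e \<in> _\<close> \<open>u \<in> _\<close> \<open>z \<in> _\<close>)
  moreover have "h u = \<one>\<^bsub>Q\<^esub>" using zu hz
    by (metis S.l_one \<open>u \<in> _\<close> \<open>z \<in> _\<close> hom_closed hom_mult hom_one)
  ultimately show ?thesis using that \<open>u \<in> _\<close> by blast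
qed

text \<open>\<open>\<one> \<ominus> n\<close> lies over the identity, so its right inverse cancels
  it from n(1 - n) = 0.\<close>

lemma idempotent_in_kernel:
  assumes "is_idempotent R n" and hn: "h n = \<zero>\<^bsub>Q\<^esub>"
  shows "n = \<zero>"
proof -
  have [simp]: "n \<in> carrier R" and nn: "n \<otimes> n = n" using assms(1) by (auto simp: is_idempotent_def)
  have "h (\<one> \<ominus> n) = \<one>\<^bsub>Q\<^esub>" by (simp add: hn R.minus_eq)
  then obtain u where [simp]: "u \<in> carrier R" and u: "(\<one> \<ominus> n) \<otimes> u = \<one>"
    using unit_lift[of "\<one> \<ominus> n"] by auto
  have "n = n \<otimes> (\<one> \<ominus> n) \<otimes> u" by (simp add: R.m_assoc u)
  also have "\<dots> = \<zero>" by (simp add: R.minus_eq R.r_distr R.r_minus nn R.r_neg)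
  finally show ?thesis .
qed

text \<open>Arbitrary lifts satisfy the equation only modulo the kernel. Cut down to eRe, the
  product has a right inverse relative to \<open>e\<close>, which absorbs the error.\<close>

lemma emb_idem_lift:
  assumes e: "is_idempotent R e" and f: "is_idempotent R f" and emb: "emb_idem Q (h e) (h f)"
  shows "emb_idem R e f"
proof -
  have [simp]: "e \<in> carrier R" "f \<in> carrier R" and ee: "e \<otimes> e = e"
    using e f by (auto simp: is_idempotent_def)
  obtain a b where [simp]: "a \<in> carrier R" "b \<in> carrier R"
    and ab: "h b \<otimes>\<^bsub>Q\<^esub> h f \<otimes>\<^bsub>Q\<^esub> h a = h e"
    using emb unfolding emb_idem_def by (metis surjE)
  define x where "x = e \<otimes> b \<otimes> f \<otimes> a \<otimes> e"
  have "h x = h e \<otimes>\<^bsub>Q\<^esub> (h b \<otimes>\<^bsub>Q\<^esub> h f \<otimes>\<^bsub>Q\<^esub> h a) \<otimes>\<^bsub>Q\<^esub> h e"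
    by (simp add: x_def S.m_assoc)
  also have "\<dots> = h e" unfolding ab by (simp add: ee flip: hom_mult)
  finally have "h x = h e" .
  moreover have "x \<in> carrier R" "e \<otimes> x = x" "x \<otimes> e = x"
    by (simp_all add: x_def R.m_assoc ee R.mult_eq_assoc[OF ee])
  ultimately obtain u where "u \<in> carrier R" "x \<otimes> u = e"
    using corner_right_inverse[OF e] by metis
  then have "(e \<otimes> b) \<otimes> f \<otimes> (a \<otimes> e \<otimes> u) = e" by (simp add: x_def R.m_assoc)
  then show ?thesis
    unfolding emb_idem_def
    by (meson R.m_closed \<open>a \<in> _\<close> \<open>b \<in> _\<close> \<open>e \<in> _\<close> \<open>u \<in> _\<close>)
qed

lemma iso_idem_hom: "iso_idem R e f \<Longrightarrow> iso_idem Q (h e) (h f)"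
  unfolding iso_idem_def by (metis hom_closed hom_mult)

lemma persp_idem_hom:
  assumes "is_idempotent R e" "is_idempotent R f" "persp_idem R e f"
  shows "persp_idem Q (h e) (h f)"
  using assms unfolding persp_idem_def is_idempotent_def by (metis hom_closed hom_mult R.m_closed)

text \<open>Isomorphisms need no lifting: the embeddings go up, and the isomorphism found in
  \<open>R\<close> is mapped back down.\<close>

lemma SB_idem_hom:
  assumes "SB_idem R"
  shows "SB_idem Q"
  unfolding SB_idem_def
proof (intro allI impI)
  fix e' f' assume "is_idempotent Q e'" "is_idempotent Q f'" and emb: "emb_idem Q e' f'" "emb_idem Q f' e'"
  then obtain e f where "is_idempotent R e" "is_idempotent R f" "e' = h e" "f' = h f"
    using idempotent_lift by metis
  then show "iso_idem Q e' f'"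
    using emb assms emb_idem_lift iso_idem_hom unfolding SB_idem_def by metis
qed

text \<open>Arbitrary lifts of the witnesses are corrected one equation at a time. The last equation
  then fails at most by an idempotent of the kernel, which must be zero.\<close>

lemma persp_idem_lift:
  assumes e: "is_idempotent R e" and f: "is_idempotent R f" and persp: "persp_idem Q (h e) (h f)"
  shows "persp_idem R e f"
proof -
  have [simp]: "e \<in> carrier R" "f \<in> carrier R" and ee: "e \<otimes> e = e" and ff: "f \<otimes> f = f"
    using e f by (auto simp: is_idempotent_def)
  obtain p1 s1 where [simp]: "p1 \<in> carrier R" "s1 \<in> carrier R"
    and p1: "h e \<otimes>\<^bsub>Q\<^esub> h p1 = h p1" "h p1 \<otimes>\<^bsub>Q\<^esub> h e = h e"
    and s1: "h f \<otimes>\<^bsub>Q\<^esub> h s1 = h s1" "h p1 \<otimes>\<^bsub>Q\<^esub> h s1 = h e"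
    and spf1: "h s1 \<otimes>\<^bsub>Q\<^esub> h p1 \<otimes>\<^bsub>Q\<^esub> h f = h f"
    using persp unfolding persp_idem_def by (metis surjE)
  \<comment> \<open>This shape forces \<open>e \<otimes> p = p\<close> and
    \<open>p \<otimes> e = e\<close>. As \<open>h p1\<close> already satisfies both, the image is
    unchanged.\<close>
  define p where "p = e \<oplus> e \<otimes> p1 \<otimes> (\<one> \<ominus> e)"
  define s2 where "s2 = f \<otimes> s1 \<otimes> e"
  have [simp]: "p \<in> carrier R" "s2 \<in> carrier R" by (simp_all add: p_def s2_def)
  have ep: "e \<otimes> p = p" by (simp add: p_def R.r_distr ee R.m_assoc R.mult_eq_assoc[OF ee])
  have pe: "p \<otimes> e = e"
    by (simp add: p_def R.l_distr R.m_assoc R.minus_eq R.l_minus ee R.r_neg)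
  have hp: "h p = h p1"
  proof -
    have "h p = h e \<oplus>\<^bsub>Q\<^esub> (h p1 \<ominus>\<^bsub>Q\<^esub> h e)"
      by (simp add: p_def R.minus_eq S.minus_eq p1 S.r_distr S.r_minus)
    then show ?thesis by (simp add: S.minus_eq S.a_lcomm[of "h e"] S.r_neg)
  qed
  have hee: "h e \<otimes>\<^bsub>Q\<^esub> h e = h e" by (simp add: ee flip: hom_mult)
  have hs2: "h s2 = h s1 \<otimes>\<^bsub>Q\<^esub> h e" by (simp add: s2_def s1)
  have fs2: "f \<otimes> s2 = s2" by (simp add: s2_def R.m_assoc R.mult_eq_assoc[OF ff])
  have s2e: "s2 \<otimes> e = s2" by (simp add: s2_def R.m_assoc ee)
  have "h (p \<otimes> s2) = h e" by (simp add: hp hs2 S.mult_eq_assoc[OF s1(2)] hee)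
  then obtain u where [simp]: "u \<in> carrier R" and u: "p \<otimes> s2 \<otimes> u = e" and hu: "h u = \<one>\<^bsub>Q\<^esub>"
    using corner_right_inverse[OF e, of "p \<otimes> s2"]
    by (metis R.m_assoc R.m_closed \<open>e \<in> _\<close> \<open>p \<in> _\<close> \<open>s2 \<in> _\<close> ep s2e)
  \<comment> \<open>The factor \<open>u\<close> lies over the identity, so
    \<open>p \<otimes> s = e\<close> becomes exact while \<open>s\<close> keeps the image of
    \<open>s2\<close>.\<close>
  define s where "s = s2 \<otimes> u"
  have [simp]: "s \<in> carrier R" by (simp add: s_def)
  have fs: "f \<otimes> s = s" by (simp add: s_def R.mult_eq_assoc[OF fs2])
  have ps: "p \<otimes> s = e" using u by (simp add: s_def R.m_assoc)
  \<comment> \<open>\<open>n\<close> is an idempotent below \<open>f\<close> with the same image as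
    \<open>f\<close>, so \<open>f \<ominus> n\<close> is an idempotent in the kernel.\<close>
  define n where "n = s \<otimes> p \<otimes> f"
  have [simp]: "n \<in> carrier R" by (simp add: n_def)
  have fn: "f \<otimes> n = n" by (simp add: n_def R.m_assoc R.mult_eq_assoc[OF fs])
  have nf: "n \<otimes> f = n" by (simp add: n_def R.m_assoc ff)
  have "n \<otimes> n = n"
    by (simp add: n_def R.m_assoc R.mult_eq_assoc[OF fs] R.mult_eq_assoc[OF ps] R.mult_eq_assoc[OF ep])
  then have "is_idempotent R (f \<ominus> n)"
    by (simp add: is_idempotent_def R.minus_eq R.l_distr R.r_distr R.l_minus R.r_minus ff fn nf
        R.l_neg R.r_neg R.a_assoc)
  moreover have "h (f \<ominus> n) = \<zero>\<^bsub>Q\<^esub>"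
  proof -
    have "h n = h s1 \<otimes>\<^bsub>Q\<^esub> (h e \<otimes>\<^bsub>Q\<^esub> h p1) \<otimes>\<^bsub>Q\<^esub> h f"
      by (simp add: n_def s_def hu hs2 hp S.m_assoc)
    also have "\<dots> = h f" by (simp add: p1 spf1)
    finally show ?thesis by (simp add: R.minus_eq S.r_neg)
  qed
  ultimately have "f \<ominus> n = \<zero>" by (rule idempotent_in_kernel)
  then have "n = f" by (metis R.minus_eq_zeroD \<open>f \<in> _\<close> \<open>n \<in> _\<close>)
  then show ?thesis
    unfolding persp_idem_def n_def using ep pe fs ps \<open>p \<in> _\<close> \<open>s \<in> _\<close> by blast
qed

lemma PSB_idem_lift:
  assumes "PSB_idem Q"
  shows "PSB_idem R"
  unfolding PSB_idem_def
proof (intro allI impI)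
  fix e f e' f'
  assume id: "is_idempotent R e" "is_idempotent R f" "is_idempotent R e'" "is_idempotent R f'"
    and f': "f \<otimes> f' = f'" "persp_idem R e f'" and e': "e \<otimes> e' = e'" "persp_idem R f e'"
  have "h f \<otimes>\<^bsub>Q\<^esub> h f' = h f'" "h e \<otimes>\<^bsub>Q\<^esub> h e' = h e'"
    using id f' e' by (metis hom_mult is_idempotent_def)+
  moreover have "persp_idem Q (h e) (h f')" "persp_idem Q (h f) (h e')"
    using id f' e' persp_idem_hom by auto
  ultimately have "persp_idem Q (h e) (h f)"
    using assms id[THEN hom_idempotent] unfolding PSB_idem_def by blast
  then show "persp_idem R e f" using id persp_idem_lift by blast
qed

end

section \<open>Direct summands of the regular module\<close>

text \<open>For an idempotent \<open>e\<close> this is the right ideal \<open>eR\<close>.\<close>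

definition fixed_by :: "('a, 'r) ring_scheme \<Rightarrow> 'a \<Rightarrow> 'a set" where
  "fixed_by R e = {x \<in> carrier R. e \<otimes>\<^bsub>R\<^esub> x = x}"

lemma right_regular_module_simps [simp]:
  "carrier (right_regular_module R) = carrier R"
  "add (right_regular_module R) = add R"
  "zero (right_regular_module R) = zero R"
  "a \<odot>\<^bsub>right_regular_module R\<^esub> x = x \<otimes>\<^bsub>R\<^esub> a"
  by (simp_all add: right_regular_module_def)

lemma subgroup_add_monoid:
  "subgroup I (add_monoid (right_regular_module R)) \<longleftrightarrow> subgroup I (add_monoid R)"
  by (simp add: subgroup_def m_inv_def)

lemma isomorphic_submodules_iff:
  "isomorphic_submodules R M A B \<longleftrightarrow>
     (\<exists>\<phi>. bij_betw \<phi> A B \<and> (\<forall>x\<in>A. \<forall>y\<in>A. \<phi> (x \<oplus>\<^bsub>M\<^esub> y) = \<phi> x \<oplus>\<^bsub>M\<^esub> \<phi> y) \<and>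
        (\<forall>a\<in>carrier R. \<forall>x\<in>A. \<phi> (a \<odot>\<^bsub>M\<^esub> x) = a \<odot>\<^bsub>M\<^esub> \<phi> x))"
  unfolding isomorphic_submodules_def module_isos_def iso_def hom_def
  by (auto dest: bij_betwE)

section \<open>Right ideals, and summands in terms of idempotents\<close>

context ring
begin

text \<open>Closure under negation is covered, being right multiplication by
  \<open>\<ominus> \<one>\<close>.\<close>

lemma right_ideal_iff:
  "right_ideal I R \<longleftrightarrow> I \<subseteq> carrier R \<and> \<zero> \<in> I \<and> (\<forall>x\<in>I. \<forall>y\<in>I. x \<oplus> y \<in> I) \<and>
     (\<forall>x\<in>I. \<forall>a\<in>carrier R. x \<otimes> a \<in> I)" (is "_ \<longleftrightarrow> ?rhs")
proof
  assume "right_ideal I R"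
  then have "submodule I R (right_regular_module R)" by (simp add: right_ideal_def)
  then interpret I: submodule I R "right_regular_module R" .
  show ?rhs
    using I.subset I.one_closed I.m_closed I.smult_closed by simp
next
  assume I: ?rhs
  have "\<ominus> x \<in> I" if "x \<in> I" for x
  proof -
    have "x \<otimes> \<ominus> \<one> = \<ominus> x" using I that by (simp add: r_minus subset_iff)
    then show ?thesis using I that by (metis a_inv_closed one_closed)
  qed
  then have "subgroup I (add_monoid R)"
    using I by (auto intro!: subgroup.intro simp: a_inv_def)
  then show "right_ideal I R"
    unfolding right_ideal_def submodule_def submodule_axioms_def subgroup_add_monoid
    using I by simp
qed

lemma submodule_restrict:
  assumes "right_ideal I R" "right_ideal K R" "I \<subseteq> K"
  shows "submodule I R ((right_regular_module R)\<lparr>carrier := K\<rparr>)"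
proof -
  have "subgroup I (add_monoid R)" "subgroup K (add_monoid R)"
    using assms unfolding right_ideal_def submodule_def subgroup_add_monoid by simp_all
  then have "subgroup I ((add_monoid R)\<lparr>carrier := K\<rparr>)"
    using assms(3) add.subgroup_incl by blast
  then show ?thesis
    using assms(1) unfolding right_ideal_iff submodule_def submodule_axioms_def
    by (simp add: subgroup_def m_inv_def)
qed

lemma right_ideal_minus:
  assumes "right_ideal I R" "x \<in> I" "y \<in> I"
  shows "x \<ominus> y \<in> I"
proof -
  have "x \<oplus> y \<otimes> \<ominus> \<one> \<in> I" using assms by (simp add: right_ideal_iff)
  then show ?thesis using assms by (simp add: right_ideal_iff subset_iff r_minus minus_eq)
qed

lemma right_ideal_fixed_by: "e \<in> carrier R \<Longrightarrow> right_ideal (fixed_by R e) R"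
  by (auto simp: right_ideal_iff fixed_by_def r_distr simp flip: m_assoc)

lemma right_ideal_annihilator: "p \<in> carrier R \<Longrightarrow> right_ideal {x \<in> carrier R. p \<otimes> x = \<zero>} R"
  by (auto simp: right_ideal_iff r_distr simp flip: m_assoc)

text \<open>\<open>p\<close> is the component of \<open>\<one>\<close> in \<open>A\<close>, and
  \<open>c\<close> the one in \<open>C\<close>. For x in \<open>A\<close>, x - px equals cx and so
  lies in both \<open>A\<close> and \<open>C\<close>; for x in \<open>C\<close>, the same holds of x
  - cx = px. Hence \<open>p\<close> fixes \<open>A\<close> and kills \<open>C\<close>.\<close>

lemma internal_direct_sum_projection:
  assumes "internal_direct_sum R (right_regular_module R) A C"
  obtains p where "is_idempotent R p" "A = fixed_by R p" "C = {x \<in> carrier R. p \<otimes> x = \<zero>}"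
proof -
  have A: "right_ideal A R" and C: "right_ideal C R"
    and sum: "A <+>\<^bsub>right_regular_module R\<^esub> C = carrier R" and int: "A \<inter> C = {\<zero>}"
    using assms by (auto simp: internal_direct_sum_def right_ideal_def)
  have AC: "A \<subseteq> carrier R" "C \<subseteq> carrier R" using A C by (auto simp: right_ideal_iff)
  have "\<one> \<in> A <+>\<^bsub>right_regular_module R\<^esub> C" by (simp add: sum)
  then obtain p c where p: "p \<in> A" and c: "c \<in> C" and pc: "\<one> = p \<oplus> c"
    by (auto simp: set_add_def')
  have [simp]: "p \<in> carrier R" "c \<in> carrier R" using p c AC by auto
  have split: "x = p \<otimes> x \<oplus> c \<otimes> x" if "x \<in> carrier R" for x
    using that pc by (metis l_distr l_one \<open>p \<in> carrier R\<close> \<open>c \<in> carrier R\<close>)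
  have px: "p \<otimes> x \<in> A" and cx: "c \<otimes> x \<in> C" if "x \<in> carrier R" for x
    using that p c A C by (auto simp: right_ideal_iff)
  have pA: "p \<otimes> x = x" if "x \<in> A" for x
  proof -
    have [simp]: "x \<in> carrier R" using that AC by blast
    have "x \<ominus> p \<otimes> x = c \<otimes> x"
      by (subst split[of x]) (simp_all add: minus_eq a_ac r_neg1 r_neg2 r_neg)
    then have "x \<ominus> p \<otimes> x \<in> A \<inter> C"
      using right_ideal_minus[OF A that px[of x]] cx[of x] by (metis IntI \<open>x \<in> carrier R\<close>)
    then show ?thesis using int minus_eq_zeroD[of x "p \<otimes> x"] by simp
  qed
  have pC: "p \<otimes> x = \<zero>" if "x \<in> C" for x
  proof -
    have [simp]: "x \<in> carrier R" using that AC by blast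
    have "x \<ominus> c \<otimes> x = p \<otimes> x"
      by (subst split[of x]) (simp_all add: minus_eq a_assoc r_neg)
    then have "p \<otimes> x \<in> A \<inter> C"
      using right_ideal_minus[OF C that cx[of x]] px[of x] by (metis IntI \<open>x \<in> carrier R\<close>)
    then show ?thesis using int by simp
  qed
  show ?thesis
  proof (rule that[of p])
    show "is_idempotent R p" using p pA by (simp add: is_idempotent_def)
    show "A = fixed_by R p" using AC pA px by (force simp: fixed_by_def)
    show "C = {x \<in> carrier R. p \<otimes> x = \<zero>}"
    proof (intro equalityI subsetI)
      fix x assume "x \<in> {x \<in> carrier R. p \<otimes> x = \<zero>}"
      then show "x \<in> C" using split[of x] cx[of x] by simp
    qed (use AC pC in auto)
  qed
qed

text \<open>Every x is spx + (x - spx), and an x fixed by \<open>f\<close> and killed by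
  \<open>p\<close> equals spfx = 0. Since the complement depends on \<open>p\<close> alone, two
  summands can share it by using different \<open>s\<close>.\<close>

lemma internal_direct_sumI:
  assumes f: "is_idempotent R f" and C: "p \<in> carrier R" "s \<in> carrier R"
    and fs: "f \<otimes> s = s" and spf: "s \<otimes> p \<otimes> f = f" and psp: "p \<otimes> s \<otimes> p = p"
  shows "internal_direct_sum R (right_regular_module R) (fixed_by R f) {x \<in> carrier R. p \<otimes> x = \<zero>}"
proof -
  have [simp]: "p \<in> carrier R" "s \<in> carrier R" "f \<in> carrier R"
    using C f by (auto simp: is_idempotent_def)
  have "\<exists>h\<in>fixed_by R f. \<exists>k\<in>{x \<in> carrier R. p \<otimes> x = \<zero>}. x = h \<oplus> k" if [simp]: "x \<in> carrier R" for x
  proof (intro bexI)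
    show "x = s \<otimes> (p \<otimes> x) \<oplus> (x \<ominus> s \<otimes> (p \<otimes> x))"
      by (simp add: minus_eq a_lcomm[of _ x] r_neg)
    show "s \<otimes> (p \<otimes> x) \<in> fixed_by R f"
      by (simp add: fixed_by_def mult_eq_assoc[OF fs])
    have "p \<otimes> (s \<otimes> (p \<otimes> x)) = p \<otimes> x" by (metis psp m_assoc C that m_closed)
    then show "x \<ominus> s \<otimes> (p \<otimes> x) \<in> {x \<in> carrier R. p \<otimes> x = \<zero>}"
      by (simp add: minus_eq r_distr r_minus r_neg)
  qed
  then have "fixed_by R f <+>\<^bsub>right_regular_module R\<^esub> {x \<in> carrier R. p \<otimes> x = \<zero>} = carrier R"
    by (auto simp: set_add_def' fixed_by_def)
  moreover have "x = \<zero>" if "x \<in> carrier R" "f \<otimes> x = x" "p \<otimes> x = \<zero>" for x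
  proof -
    have "x = s \<otimes> p \<otimes> f \<otimes> x" by (simp add: spf that)
    also have "\<dots> = \<zero>" using that by (simp add: m_assoc)
    finally show ?thesis .
  qed
  ultimately show ?thesis
    using right_ideal_fixed_by[of f] right_ideal_annihilator[of p]
    by (auto simp: internal_direct_sum_def right_ideal_def fixed_by_def)
qed

lemma direct_summand_iff:
  "direct_summand R (right_regular_module R) A \<longleftrightarrow> (\<exists>e. is_idempotent R e \<and> A = fixed_by R e)"
proof
  assume "direct_summand R (right_regular_module R) A"
  then obtain C where "internal_direct_sum R (right_regular_module R) A C"
    by (auto simp: direct_summand_def)
  then show "\<exists>e. is_idempotent R e \<and> A = fixed_by R e"
    using internal_direct_sum_projection by blast
next
  assume "\<exists>e. is_idempotent R e \<and> A = fixed_by R e"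
  then obtain e where e: "is_idempotent R e" and A: "A = fixed_by R e" by blast
  show "direct_summand R (right_regular_module R) A"
    unfolding A direct_summand_def
    using internal_direct_sumI[OF e, of e e] e by (auto simp: is_idempotent_def)
qed

text \<open>An instance of the modular law: the kernel of \<open>g\<close> is cut down to fR, and x
  - gx stays in fR because gR does.\<close>

lemma direct_summand_fixed_by:
  assumes f: "is_idempotent R f" and g: "is_idempotent R g" and fg: "f \<otimes> g = g"
  shows "direct_summand R ((right_regular_module R)\<lparr>carrier := fixed_by R f\<rparr>) (fixed_by R g)"
  unfolding direct_summand_def
proof
  have [simp]: "f \<in> carrier R" "g \<in> carrier R" and gg: "g \<otimes> g = g"
    using f g by (auto simp: is_idempotent_def)
  let ?K = "fixed_by R f \<inter> {x \<in> carrier R. g \<otimes> x = \<zero>}"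
  have K: "right_ideal ?K R"
    using right_ideal_fixed_by[of f] right_ideal_annihilator[of g] by (auto simp: right_ideal_iff)
  have gf: "fixed_by R g \<subseteq> fixed_by R f"
    using fg by (auto simp: fixed_by_def) (metis \<open>f \<in> _\<close> \<open>g \<in> _\<close> m_assoc)
  have "\<exists>h\<in>fixed_by R g. \<exists>k\<in>?K. x = h \<oplus> k" if "x \<in> carrier R" "f \<otimes> x = x" for x
  proof (intro bexI)
    show "x = g \<otimes> x \<oplus> (x \<ominus> g \<otimes> x)"
      using that by (simp add: minus_eq a_lcomm[of _ x] r_neg)
    show "g \<otimes> x \<in> fixed_by R g"
      using that by (simp add: fixed_by_def mult_eq_assoc[OF gg])
    show "x \<ominus> g \<otimes> x \<in> ?K"
      using that by (simp add: fixed_by_def minus_eq r_distr r_minus r_neg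
          mult_eq_assoc[OF gg] mult_eq_assoc[OF fg])
  qed
  moreover have "h \<oplus> k \<in> fixed_by R f" if "h \<in> fixed_by R g" "k \<in> ?K" for h k
    using that gf right_ideal_fixed_by[of f] by (auto simp: right_ideal_iff)
  ultimately have "fixed_by R g <+>\<^bsub>(right_regular_module R)\<lparr>carrier := fixed_by R f\<rparr>\<^esub> ?K = fixed_by R f"
    unfolding set_add_def' by (fastforce simp: fixed_by_def)
  then show "internal_direct_sum R ((right_regular_module R)\<lparr>carrier := fixed_by R f\<rparr>) (fixed_by R g) ?K"
    using gf K right_ideal_fixed_by[of f] right_ideal_fixed_by[of g]
    by (auto simp: internal_direct_sum_def fixed_by_def intro!: submodule_restrict)
qed

text \<open>A linear map out of eR is left multiplication by its value at \<open>e\<close>. The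
  witnesses are therefore the image of \<open>e\<close> and the preimage of
  \<open>f\<close>.\<close>

lemma isomorphic_fixed_by_iff:
  assumes e: "is_idempotent R e" and f: "is_idempotent R f"
  shows "isomorphic_submodules R (right_regular_module R) (fixed_by R e) (fixed_by R f)
    \<longleftrightarrow> iso_idem R e f"
proof
  have [simp]: "e \<in> carrier R" "f \<in> carrier R" and ee: "e \<otimes> e = e" and ff: "f \<otimes> f = f"
    using e f by (auto simp: is_idempotent_def)
  assume "isomorphic_submodules R (right_regular_module R) (fixed_by R e) (fixed_by R f)"
  then obtain \<phi> where bij: "bij_betw \<phi> (fixed_by R e) (fixed_by R f)"
    and lin: "\<And>a x. \<lbrakk>a \<in> carrier R; x \<in> fixed_by R e\<rbrakk> \<Longrightarrow> \<phi> (x \<otimes> a) = \<phi> x \<otimes> a"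
    by (auto simp: isomorphic_submodules_iff)
  have eF: "e \<in> fixed_by R e" and fF: "f \<in> fixed_by R f" by (simp_all add: fixed_by_def ee ff)
  have "\<phi> e \<in> fixed_by R f" using bij eF by (rule bij_betwE[rule_format])
  then have [simp]: "\<phi> e \<in> carrier R" and fa: "f \<otimes> \<phi> e = \<phi> e" by (simp_all add: fixed_by_def)
  obtain b where bF: "b \<in> fixed_by R e" and \<phi>b: "\<phi> b = f"
    using bij fF by (metis bij_betw_iff_bijections)
  then have [simp]: "b \<in> carrier R" and eb: "e \<otimes> b = b" by (simp_all add: fixed_by_def)
  have ab: "\<phi> e \<otimes> b = f" using lin[OF _ eF, of b] by (simp add: eb \<phi>b)
  have "\<phi> (b \<otimes> \<phi> e) = \<phi> e" using lin[OF _ bF, of "\<phi> e"] by (simp add: \<phi>b fa)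
  moreover have "b \<otimes> \<phi> e \<in> fixed_by R e"
    by (simp add: fixed_by_def mult_eq_assoc[OF eb])
  ultimately have "b \<otimes> \<phi> e = e" using bij eF by (auto simp: bij_betw_def dest: inj_onD)
  then show "iso_idem R e f"
    unfolding iso_idem_def using ab by (intro bexI[of _ "\<phi> e"] bexI[of _ b] conjI) simp_all
next
  have [simp]: "e \<in> carrier R" "f \<in> carrier R" using e f by (auto simp: is_idempotent_def)
  assume "iso_idem R e f"
  then obtain a b where [simp]: "a \<in> carrier R" "b \<in> carrier R" and ab: "a \<otimes> b = f" "b \<otimes> a = e"
    and fa: "f \<otimes> a = a" and eb: "e \<otimes> b = b"
    using iso_idemE[OF _ e f] by metis
  have "bij_betw ((\<otimes>) a) (fixed_by R e) (fixed_by R f)"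
    by (rule bij_betw_byWitness[where f' = "(\<otimes>) b"])
      (auto simp: fixed_by_def mult_eq_assoc[OF ab(1)] mult_eq_assoc[OF ab(2)]
        mult_eq_assoc[OF fa] mult_eq_assoc[OF eb])
  then show "isomorphic_submodules R (right_regular_module R) (fixed_by R e) (fixed_by R f)"
    unfolding isomorphic_submodules_iff
    by (intro exI[of _ "(\<otimes>) a"]) (auto simp: fixed_by_def r_distr m_assoc)
qed

text \<open>Left multiplication by \<open>f \<otimes> a\<close> embeds eR into fR, with retraction
  \<open>e \<otimes> b\<close>. Their composite \<open>g\<close> projects onto the image.\<close>

lemma emb_idem_summand:
  assumes e: "is_idempotent R e" and f: "is_idempotent R f" and emb: "emb_idem R e f"
  shows "\<exists>B'. direct_summand R ((right_regular_module R)\<lparr>carrier := fixed_by R f\<rparr>) B' \<and>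
    isomorphic_submodules R (right_regular_module R) (fixed_by R e) B'"
proof -
  have [simp]: "e \<in> carrier R" "f \<in> carrier R" and ee: "e \<otimes> e = e" and ff: "f \<otimes> f = f"
    using e f by (auto simp: is_idempotent_def)
  obtain a b where [simp]: "a \<in> carrier R" "b \<in> carrier R" and bfa: "b \<otimes> f \<otimes> a = e"
    using emb unfolding emb_idem_def by blast
  define g where "g = f \<otimes> a \<otimes> e \<otimes> b"
  have [simp]: "g \<in> carrier R" by (simp add: g_def)
  have bfax: "b \<otimes> (f \<otimes> (a \<otimes> x)) = e \<otimes> x" if "x \<in> carrier R" for x
    using that by (simp flip: bfa add: m_assoc)
  have fg: "f \<otimes> g = g" by (simp add: g_def m_assoc mult_eq_assoc[OF ff])
  have "g \<otimes> g = g" by (simp add: g_def m_assoc bfax mult_eq_assoc[OF ee])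
  then have g: "is_idempotent R g" by (simp add: is_idempotent_def)
  have "f \<otimes> a \<otimes> e \<otimes> (e \<otimes> b) = g" by (simp add: g_def m_assoc mult_eq_assoc[OF ee])
  moreover have "e \<otimes> b \<otimes> (f \<otimes> a \<otimes> e) = e" by (simp add: m_assoc bfax ee)
  ultimately have "iso_idem R e g"
    unfolding iso_idem_def
    by (intro bexI[of _ "f \<otimes> a \<otimes> e"] bexI[of _ "e \<otimes> b"]) simp_all
  then show ?thesis
    using direct_summand_fixed_by[OF f g fg] isomorphic_fixed_by_iff[OF e g] by blast
qed

section \<open>Passage between the module and idempotent forms of SB and PSB\<close>

lemma SB_idem_if_SB_ring:
  assumes "SB_ring R"
  shows "SB_idem R"
  unfolding SB_idem_def
proof (intro allI impI)
  fix e f assume "is_idempotent R e" "is_idempotent R f" "emb_idem R e f" "emb_idem R f e"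
  moreover from this have "direct_summand R (right_regular_module R) (fixed_by R e)"
    "direct_summand R (right_regular_module R) (fixed_by R f)"
    by (auto simp: direct_summand_iff)
  ultimately have "isomorphic_submodules R (right_regular_module R) (fixed_by R e) (fixed_by R f)"
    using assms emb_idem_summand[of e f] emb_idem_summand[of f e]
    unfolding SB_ring_def SB_module_def by blast
  then show "iso_idem R e f"
    using \<open>is_idempotent R e\<close> \<open>is_idempotent R f\<close> by (simp add: isomorphic_fixed_by_iff)
qed

text \<open>If \<open>p\<close> and \<open>q\<close> project onto eR and fR along the same
  \<open>C\<close>, then 1 - q and 1 - p lie in \<open>C\<close>, so pq = p and qp = q, and
  \<open>q \<otimes> e\<close> serves as the inverse map. Conversely, the kernel of \<open>p\<close>
  is the common complement.\<close>

lemma perspective_fixed_by_iff: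
  assumes e: "is_idempotent R e" and f: "is_idempotent R f"
  shows "perspective R (right_regular_module R) (fixed_by R e) (fixed_by R f) \<longleftrightarrow> persp_idem R e f"
proof
  have [simp]: "e \<in> carrier R" "f \<in> carrier R" and ee: "e \<otimes> e = e" and ff: "f \<otimes> f = f"
    using e f by (auto simp: is_idempotent_def)
  assume "perspective R (right_regular_module R) (fixed_by R e) (fixed_by R f)"
  then obtain C where eC: "internal_direct_sum R (right_regular_module R) (fixed_by R e) C"
    and fC: "internal_direct_sum R (right_regular_module R) (fixed_by R f) C"
    unfolding perspective_def by blast
  obtain p where p: "is_idempotent R p" and ep: "fixed_by R e = fixed_by R p"
    and Cp: "C = {x \<in> carrier R. p \<otimes> x = \<zero>}"
    using internal_direct_sum_projection[OF eC] .
  obtain q where q: "is_idempotent R q" and fq: "fixed_by R f = fixed_by R q"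
    and Cq: "C = {x \<in> carrier R. q \<otimes> x = \<zero>}"
    using internal_direct_sum_projection[OF fC] .
  have [simp]: "p \<in> carrier R" "q \<in> carrier R" and pp: "p \<otimes> p = p" and qq: "q \<otimes> q = q"
    using p q by (auto simp: is_idempotent_def)
  have "p \<in> fixed_by R p" "e \<in> fixed_by R e" "q \<in> fixed_by R q" "f \<in> fixed_by R f"
    by (auto simp: fixed_by_def pp qq ee ff)
  then have "p \<in> fixed_by R e" "e \<in> fixed_by R p" "q \<in> fixed_by R f" "f \<in> fixed_by R q"
    using ep fq by auto
  then have pe: "p \<otimes> e = e" "e \<otimes> p = p" "q \<otimes> f = f" "f \<otimes> q = q"
    by (auto simp: fixed_by_def)
  have "\<one> \<ominus> q \<in> C" by (simp add: Cq minus_eq r_distr r_minus qq r_neg)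
  then have "p \<ominus> p \<otimes> q = \<zero>" by (simp add: Cp minus_eq r_distr r_minus)
  then have pq: "p \<otimes> q = p" using minus_eq_zeroD[of p "p \<otimes> q"] by simp
  have "\<one> \<ominus> p \<in> C" by (simp add: Cp minus_eq r_distr r_minus pp r_neg)
  then have "q \<ominus> q \<otimes> p = \<zero>" by (simp add: Cq minus_eq r_distr r_minus)
  then have qp: "q \<otimes> p = q" using minus_eq_zeroD[of q "q \<otimes> p"] by simp
  show "persp_idem R e f"
    unfolding persp_idem_def
  proof (intro bexI conjI)
    show "p \<otimes> (q \<otimes> e) = e" by (simp add: mult_eq_assoc[OF pq] pe)
    show "f \<otimes> (q \<otimes> e) = q \<otimes> e" by (simp add: mult_eq_assoc[OF pe(4)])
    show "q \<otimes> e \<otimes> p \<otimes> f = f" by (simp add: m_assoc mult_eq_assoc[OF pe(2)] mult_eq_assoc[OF qp] pe)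
  qed (simp_all add: pe)
next
  have [simp]: "e \<in> carrier R" "f \<in> carrier R" and ee: "e \<otimes> e = e"
    using e f by (auto simp: is_idempotent_def)
  assume "persp_idem R e f"
  then obtain p s where [simp]: "p \<in> carrier R" "s \<in> carrier R"
    and ep: "e \<otimes> p = p" and pe: "p \<otimes> e = e" and fs: "f \<otimes> s = s" and ps: "p \<otimes> s = e"
    and spf: "s \<otimes> p \<otimes> f = f"
    unfolding persp_idem_def by blast
  have "internal_direct_sum R (right_regular_module R) (fixed_by R e) {x \<in> carrier R. p \<otimes> x = \<zero>}"
    by (rule internal_direct_sumI[OF e, of _ e]) (simp_all add: ee ep pe)
  moreover
  have "internal_direct_sum R (right_regular_module R) (fixed_by R f) {x \<in> carrier R. p \<otimes> x = \<zero>}"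
    by (rule internal_direct_sumI[OF f, of _ s]) (simp_all add: fs spf ps ep)
  ultimately show "perspective R (right_regular_module R) (fixed_by R e) (fixed_by R f)"
    unfolding perspective_def by blast
qed

lemma PSB_ring_if_PSB_idem:
  assumes "PSB_idem R"
  shows "PSB_ring R"
proof -
  \<comment> \<open>\<open>B'\<close> is given as a summand of fR, but perspectivity in R makes it a
    summand of R and hence of the form gR.\<close>
  have below: "\<exists>g. is_idempotent R g \<and> f \<otimes> g = g \<and> persp_idem R e g"
    if "is_idempotent R e" and "direct_summand R ((right_regular_module R)\<lparr>carrier := fixed_by R f\<rparr>) B'"
      and persp: "perspective R (right_regular_module R) (fixed_by R e) B'" for e f B'
  proof -
    have "direct_summand R (right_regular_module R) B'"
      using persp unfolding perspective_def direct_summand_def by blast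
    then obtain g where g: "is_idempotent R g" and B': "B' = fixed_by R g"
      by (auto simp: direct_summand_iff)
    have "B' \<subseteq> fixed_by R f"
      using that(2) submodule.axioms(1)[THEN subgroup.subset]
      unfolding direct_summand_def internal_direct_sum_def by fastforce
    moreover have "g \<in> B'" using g by (simp add: B' fixed_by_def is_idempotent_def)
    ultimately have "f \<otimes> g = g" by (auto simp: fixed_by_def)
    then show ?thesis using g persp perspective_fixed_by_iff that(1) unfolding B' by blast
  qed
  show ?thesis
    unfolding PSB_ring_def PSB_module_def
  proof (intro allI impI)
    fix A B
    assume "direct_summand R (right_regular_module R) A" "direct_summand R (right_regular_module R) B"
      and A: "\<exists>B'. direct_summand R ((right_regular_module R)\<lparr>carrier := B\<rparr>) B' \<and>
        perspective R (right_regular_module R) A B'"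
      and B: "\<exists>A'. direct_summand R ((right_regular_module R)\<lparr>carrier := A\<rparr>) A' \<and>
        perspective R (right_regular_module R) B A'"
    then obtain e f where e: "is_idempotent R e" "A = fixed_by R e"
      and f: "is_idempotent R f" "B = fixed_by R f"
      by (auto simp: direct_summand_iff)
    have "persp_idem R e f"
      using assms below[OF e(1)] below[OF f(1)] A B e f unfolding PSB_idem_def by metis
    then show "perspective R (right_regular_module R) A B"
      using perspective_fixed_by_iff e f by blast
  qed
qed

section \<open>The Jacobson radical\<close>

lemma ex_maximal_right_ideal:
  assumes K: "right_ideal K R" and "\<one> \<notin> K"
  obtains I where "maximal_right_ideal I R" "K \<subseteq> I"
proof -
  \<comment> \<open>Properness is phrased as omitting \<open>\<one>\<close>, a condition that passes
    to unions of chains.\<close>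
  define \<A> where "\<A> = {I. right_ideal I R \<and> K \<subseteq> I \<and> \<one> \<notin> I}"
  have "\<exists>M\<in>\<A>. \<forall>X\<in>\<A>. M \<subseteq> X \<longrightarrow> X = M"
  proof (rule subset_Zorn_nonempty)
    show "\<A> \<noteq> {}" using assms by (auto simp: \<A>_def)
  next
    fix \<C> assume ne: "\<C> \<noteq> {}" and chain: "subset.chain \<A> \<C>"
    then have sub: "\<And>I. I \<in> \<C> \<Longrightarrow> right_ideal I R \<and> K \<subseteq> I \<and> \<one> \<notin> I"
      by (auto simp: \<A>_def subset.chain_def)
    have "right_ideal (\<Union>\<C>) R"
      unfolding right_ideal_iff
    proof (intro conjI ballI)
      show "\<Union>\<C> \<subseteq> carrier R" using sub by (meson Sup_least right_ideal_iff)
      show "\<zero> \<in> \<Union>\<C>" using sub ne by (meson UnionI ex_in_conv right_ideal_iff)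
    next
      fix x y assume "x \<in> \<Union>\<C>" "y \<in> \<Union>\<C>"
      then obtain I L where "I \<in> \<C>" "x \<in> I" "L \<in> \<C>" "y \<in> L" by blast
      moreover then have "I \<subseteq> L \<or> L \<subseteq> I" using chain by (auto simp: subset.chain_def)
      ultimately obtain N where N: "N \<in> \<C>" "x \<in> N" "y \<in> N" by blast
      then have "x \<oplus> y \<in> N" using sub[OF N(1)] by (simp add: right_ideal_iff)
      then show "x \<oplus> y \<in> \<Union>\<C>" using N(1) by blast
    next
      fix x a assume "x \<in> \<Union>\<C>" and a: "a \<in> carrier R"
      then obtain I where I: "I \<in> \<C>" "x \<in> I" by blast
      then have "x \<otimes> a \<in> I" using sub[OF I(1)] a by (simp add: right_ideal_iff)
      then show "x \<otimes> a \<in> \<Union>\<C>" using I(1) by blast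
    qed
    then show "\<Union>\<C> \<in> \<A>" using ne sub by (auto simp: \<A>_def)
  qed
  then obtain I where I: "right_ideal I R" "K \<subseteq> I" "\<one> \<notin> I"
    and max: "\<And>X. \<lbrakk>right_ideal X R; I \<subseteq> X; \<one> \<notin> X\<rbrakk> \<Longrightarrow> X = I"
    by (auto simp: \<A>_def)
  have "X = I \<or> X = carrier R" if "right_ideal X R" "I \<subseteq> X" for X
  proof (cases "\<one> \<in> X")
    case True
    then have "X = carrier R" using that(1) by (fastforce simp: right_ideal_iff)
    then show ?thesis ..
  qed (use max that in blast)
  moreover have "I \<noteq> carrier R" using I by blast
  ultimately have "maximal_right_ideal I R" using I by (auto simp: maximal_right_ideal_def)
  then show ?thesis using that I by blast
qed

lemma one_notin_maximal_right_ideal: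
  assumes "maximal_right_ideal I R"
  shows "\<one> \<notin> I"
proof
  assume "\<one> \<in> I"
  then have "I = carrier R"
    using assms unfolding maximal_right_ideal_def right_ideal_iff by force
  then show False using assms by (simp add: maximal_right_ideal_def)
qed

text \<open>Otherwise (1 + j)R lies in a maximal right ideal, which also contains \<open>j\<close>
  and therefore \<open>\<one>\<close>.\<close>

lemma jacobson_radical_right_inverse:
  assumes j: "j \<in> jacobson_radical R"
  shows "\<exists>u\<in>carrier R. (\<one> \<oplus> j) \<otimes> u = \<one>"
proof (rule ccontr)
  assume neg: "\<not> ?thesis"
  have [simp]: "j \<in> carrier R" using j by (simp add: jacobson_radical_def)
  let ?K = "{(\<one> \<oplus> j) \<otimes> u | u. u \<in> carrier R}"
  have "right_ideal ?K R"
    unfolding right_ideal_iff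
  proof (intro conjI ballI)
    show "\<zero> \<in> ?K" using r_null[of "\<one> \<oplus> j"] zero_closed by force
  next
    fix x y assume "x \<in> ?K" "y \<in> ?K"
    then obtain u v where uv: "u \<in> carrier R" "v \<in> carrier R"
      "x = (\<one> \<oplus> j) \<otimes> u" "y = (\<one> \<oplus> j) \<otimes> v" by blast
    then have "x \<oplus> y = (\<one> \<oplus> j) \<otimes> (u \<oplus> v)" by (simp add: r_distr)
    then show "x \<oplus> y \<in> ?K" using uv by blast
  next
    fix x a assume "x \<in> ?K" "a \<in> carrier R"
    moreover then obtain u where "u \<in> carrier R" "x = (\<one> \<oplus> j) \<otimes> u" by blast
    ultimately have "x \<otimes> a = (\<one> \<oplus> j) \<otimes> (u \<otimes> a)" "u \<otimes> a \<in> carrier R" by (simp_all add: m_assoc)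
    then show "x \<otimes> a \<in> ?K" by blast
  qed auto
  moreover have "\<one> \<notin> ?K"
  proof
    assume "\<one> \<in> ?K"
    then obtain u where "u \<in> carrier R" "\<one> = (\<one> \<oplus> j) \<otimes> u" by blast
    then show False using neg by metis
  qed
  ultimately obtain I where I: "maximal_right_ideal I R" "?K \<subseteq> I"
    by (rule ex_maximal_right_ideal)
  have rI: "right_ideal I R" using I by (simp add: maximal_right_ideal_def)
  have "(\<one> \<oplus> j) \<otimes> \<one> \<in> I" using I(2) by blast
  moreover have "j \<in> I" using j I(1) by (simp add: jacobson_radical_def)
  ultimately have "(\<one> \<oplus> j) \<ominus> j \<in> I" using right_ideal_minus[OF rI] by simp
  then have "\<one> \<in> I" by (simp add: minus_eq a_assoc r_neg)
  then show False using one_notin_maximal_right_ideal I(1) by blast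
qed

text \<open>This is what makes the intersection of the maximal right ideals a left ideal.\<close>

lemma maximal_right_ideal_residual:
  assumes I: "maximal_right_ideal I R" and [simp]: "r \<in> carrier R" and "r \<notin> I"
  shows "maximal_right_ideal {x \<in> carrier R. r \<otimes> x \<in> I} R" (is "maximal_right_ideal ?L R")
  unfolding maximal_right_ideal_def
proof (intro conjI allI impI)
  have rI: "right_ideal I R" and Ic: "I \<subseteq> carrier R"
    and max: "\<And>K. \<lbrakk>right_ideal K R; I \<subseteq> K\<rbrakk> \<Longrightarrow> K = I \<or> K = carrier R"
    using I by (auto simp: maximal_right_ideal_def right_ideal_iff)
  show "right_ideal ?L R"
    using rI by (auto simp: right_ideal_iff r_distr simp flip: m_assoc)
  have "\<one> \<notin> ?L" using assms by simp
  then show "?L \<noteq> carrier R" by blast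
  fix K assume K: "right_ideal K R" "?L \<subseteq> K"
  have Kc: "K \<subseteq> carrier R" using K by (simp add: right_ideal_iff)
  show "K = ?L \<or> K = carrier R"
  proof (cases "K \<subseteq> ?L")
    case False
    then obtain k where k: "k \<in> K" "r \<otimes> k \<notin> I" using Kc by blast
    then have [simp]: "k \<in> carrier R" using Kc by blast
    \<comment> \<open>The right ideal rkR + I contains \<open>r \<otimes> k\<close>, which is not in
      \<open>I\<close>, so maximality makes it the whole ring.\<close>
    let ?N = "{r \<otimes> k \<otimes> y \<oplus> i | y i. y \<in> carrier R \<and> i \<in> I}"
    have "right_ideal ?N R"
      unfolding right_ideal_iff
    proof (intro conjI ballI)
      show "?N \<subseteq> carrier R" using Ic by auto
      have "\<zero> = r \<otimes> k \<otimes> \<zero> \<oplus> \<zero>" by simp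
      then show "\<zero> \<in> ?N" using rI unfolding right_ideal_iff by blast
    next
      fix x x' assume "x \<in> ?N" "x' \<in> ?N"
      then obtain y i y' i' where y: "y \<in> carrier R" "i \<in> I" "y' \<in> carrier R" "i' \<in> I"
        and x: "x = r \<otimes> k \<otimes> y \<oplus> i" "x' = r \<otimes> k \<otimes> y' \<oplus> i'" by blast
      have "i \<in> carrier R" "i' \<in> carrier R" using y Ic by auto
      then have "x \<oplus> x' = r \<otimes> k \<otimes> (y \<oplus> y') \<oplus> (i \<oplus> i')"
        using y by (simp add: x r_distr a_ac)
      moreover have "i \<oplus> i' \<in> I" using y rI by (simp add: right_ideal_iff)
      ultimately show "x \<oplus> x' \<in> ?N" using y by blast
    next
      fix x a assume "x \<in> ?N" and a: "a \<in> carrier R"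
      then obtain y i where y: "y \<in> carrier R" "i \<in> I" and x: "x = r \<otimes> k \<otimes> y \<oplus> i" by blast
      have "i \<in> carrier R" using y Ic by auto
      then have "x \<otimes> a = r \<otimes> k \<otimes> (y \<otimes> a) \<oplus> i \<otimes> a"
        using y a by (simp add: x l_distr m_assoc)
      moreover have "i \<otimes> a \<in> I" using y a rI by (simp add: right_ideal_iff)
      ultimately show "x \<otimes> a \<in> ?N" using y a by blast
    qed
    moreover have "I \<subseteq> ?N"
    proof
      fix i assume "i \<in> I"
      moreover then have "i = r \<otimes> k \<otimes> \<zero> \<oplus> i" using Ic by auto
      ultimately show "i \<in> ?N" by blast
    qed
    moreover have "r \<otimes> k = r \<otimes> k \<otimes> \<one> \<oplus> \<zero>" by simp
    then have "r \<otimes> k \<in> ?N" using rI unfolding right_ideal_iff by blast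
    ultimately have N: "?N = carrier R" using max k(2) by blast
    have "\<one> \<in> K"
    proof -
      \<comment> \<open>Writing r = rky + i gives r(1 - ky) = i in \<open>I\<close>, so 1 - ky lies
        in \<open>?L\<close> and hence in \<open>K\<close>. Since ky is in \<open>K\<close> too, so
        is \<open>\<one>\<close>.\<close>
      have "r \<in> ?N" by (simp only: N) simp
      then obtain y i where y [simp]: "y \<in> carrier R" and i: "i \<in> I" and r: "r = r \<otimes> k \<otimes> y \<oplus> i"
        by blast
      have [simp]: "i \<in> carrier R" using i Ic by blast
      have "r \<otimes> (\<one> \<ominus> k \<otimes> y) = r \<ominus> r \<otimes> k \<otimes> y"
        by (simp add: minus_eq r_distr r_minus m_assoc)
      also have "\<dots> = (r \<otimes> k \<otimes> y \<oplus> i) \<ominus> r \<otimes> k \<otimes> y" using r by simp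
      also have "\<dots> = i" by (simp add: minus_eq a_ac r_neg r_neg1 r_neg2)
      finally have "\<one> \<ominus> k \<otimes> y \<in> K" using i K(2) by auto
      moreover have "k \<otimes> y \<in> K" using k K(1) by (simp add: right_ideal_iff)
      ultimately have "(\<one> \<ominus> k \<otimes> y) \<oplus> k \<otimes> y \<in> K" using K(1) by (simp add: right_ideal_iff)
      then show ?thesis by (simp add: minus_eq a_assoc l_neg)
    qed
    then have "K = carrier R" using K(1) by (fastforce simp: right_ideal_iff)
    then show ?thesis ..
  qed (use K in blast)
qed

text \<open>Only left multiplication by \<open>r\<close> needs an argument. If \<open>r\<close> is
  in a maximal right ideal, so is \<open>r \<otimes> a\<close>; if not, the residual is again a
  maximal right ideal and so contains \<open>a\<close>.\<close>

lemma ideal_jacobson_radical: "ideal (jacobson_radical R) R"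
proof (rule idealI)
  have J: "right_ideal (jacobson_radical R) R"
    unfolding right_ideal_iff jacobson_radical_def
    by (auto simp: maximal_right_ideal_def right_ideal_iff)
  then show "subgroup (jacobson_radical R) (add_monoid R)"
    by (simp only: right_ideal_def submodule_def subgroup_add_monoid)
  show "a \<otimes> x \<in> jacobson_radical R" if "a \<in> jacobson_radical R" "x \<in> carrier R" for a x
    using J that by (simp add: right_ideal_iff)
  show "r \<otimes> a \<in> jacobson_radical R" if a: "a \<in> jacobson_radical R" and r: "r \<in> carrier R" for a r
  proof -
    have [simp]: "a \<in> carrier R" using a by (simp add: jacobson_radical_def)
    have "r \<otimes> a \<in> I" if I: "maximal_right_ideal I R" for I
    proof (cases "r \<in> I")
      case True
      then show ?thesis using I by (simp add: maximal_right_ideal_def right_ideal_iff)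
    next
      case False
      then show ?thesis
        using maximal_right_ideal_residual[OF I r] a by (auto simp: jacobson_radical_def)
    qed
    then show ?thesis using r by (simp add: jacobson_radical_def)
  qed
qed (rule ring_axioms)

lemma lifting_hom_jacobson_radical:
  assumes "idempotents_lift_modulo R (jacobson_radical R)"
  shows "lifting_hom R (R Quot jacobson_radical R) ((+>) (jacobson_radical R))"
proof -
  interpret J: ideal "jacobson_radical R" R by (rule ideal_jacobson_radical)
  show ?thesis
  proof (intro lifting_hom.intro lifting_hom_axioms.intro)
    show "ring_hom_ring R (R Quot jacobson_radical R) ((+>) (jacobson_radical R))"
      by (rule J.rcos_ring_hom_ring)
    show "(+>) (jacobson_radical R) ` carrier R = carrier (R Quot jacobson_radical R)"
      by (auto simp: FactRing_def A_RCOSETS_def')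
  next
    fix x assume [simp]: "x \<in> carrier R"
      and "jacobson_radical R +> x = \<one>\<^bsub>R Quot jacobson_radical R\<^esub>"
    \<comment> \<open>Equality of cosets makes x the sum of \<open>\<one>\<close> and a radical
      element, so it is right invertible.\<close>
    then have "x \<in> jacobson_radical R +> \<one>" using J.a_rcos_self[of x] by (simp add: FactRing_def)
    then obtain j where "j \<in> jacobson_radical R" "x = j \<oplus> \<one>" by (auto simp: a_r_coset_def')
    then show "\<exists>u\<in>carrier R. x \<otimes> u = \<one>"
      using jacobson_radical_right_inverse[of j] by (simp add: a_comm)
  next
    fix u assume "is_idempotent (R Quot jacobson_radical R) u"
    then show "\<exists>e. is_idempotent R e \<and> jacobson_radical R +> e = u"
      using assms by (auto simp: is_idempotent_def idempotents_lift_modulo_def)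
  qed
qed

end

theorem theorem2p6:
  fixes S :: "('a, 'm) ring_scheme"
  assumes "ring S"
    and "semiregular S"
    and "SB_ring S"
  shows "PSB_ring (S Quot jacobson_radical S) \<and> PSB_ring S"
proof -
  interpret S: ring S by fact
  have reg: "von_neumann_regular (S Quot jacobson_radical S)"
    and lift: "idempotents_lift_modulo S (jacobson_radical S)"
    using assms(2) by (auto simp: semiregular_def)
  interpret h: lifting_hom S "S Quot jacobson_radical S" "(+>\<^bsub>S\<^esub>) (jacobson_radical S)"
    using lift by (rule S.lifting_hom_jacobson_radical)
  have "SB_idem (S Quot jacobson_radical S)"
    using assms(3) by (intro h.SB_idem_hom S.SB_idem_if_SB_ring)
  with reg have PSB: "PSB_idem (S Quot jacobson_radical S)"
    by (rule h.S.PSB_idem_if_regular)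
  then show ?thesis
    using h.S.PSB_ring_if_PSB_idem S.PSB_ring_if_PSB_idem h.PSB_idem_lift by blast
qed

end
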